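(* Assume $c_\star>2$. There is an event $\Omega'\subset\Omega$ with $\mathbb P(\Omega')=1$ such that for all $0<t<\infty$, any constant $c_\circ>0$ and any sequence $a_n>0$, on $\Omega'$, for all but a finite number of indices $n$, $$P\Big(1\le k_n^\dagger(t)/k_n^\circ(t)\le 1+n^{-c_\circ}\Big)\ge 1-n^{-2(c_\star-1)+c_\circ}\big(1+\mathcal O(n^{-(c_\star-1)})\big).$$
   Context: Let $\mathcal V_n=\{-1,1\}^n$, $\mathcal E_n$ the nearest-neighbour edges ($x,y$ differing in exactly one coordinate). Let $(g(x))_{x\in\mathcal V_n}$, $n\ge1$, be i.i.d. standard Gaussians on $(\Omega,\mathcal F,\mathbb P)$. Given $c_\star>0$, $u_n$ satisfies $\mathbb P(g(x)\le-u_n)=n^{-c_\star}$; $H_n(x)=\sqrt n g(x)$ if $g(x)\le-u_n$, else $0$; $\beta>0$. Call $x$ occupied if $g(x)\le-u_n$; $I_n^\star$ = occupied vertices with no occupied neighbour; $\mathcal V_n^\star$ = occupied vertices not in $I_n^\star$; $\mathcal V_n^\circ=\mathcal V_n\setminus\mathcal V_n^\star$. $J_n$ is the Markov chain on $\mathcal V_n$ with $p_n(x,y)=e^{-\beta[H_n(y)-H_n(x)]^+}/\sum_{y':(x,y')\in\mathcal E_n}e^{-\beta[H_n(y')-H_n(x)]^+}$ on edges and $0$ otherwise, started from the uniform distribution on $\mathcal V_n^\circ$; $P$ is its law given the environment. Let $k_n^\circ(t)=\lfloor a_nt\rfloor$, $K_n(t)=\min\{k\ge1:\sum_{i=0}^{k-1}\mathbb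 1_{\{J_n(i)\in\mathcal V_n^\circ\}}=\lfloor a_nt\rfloor\}$, and $k_n^\dagger(t)=\lfloor a_nt\rfloor+\#\{1\le i\le K_n(t)-1: J_n(i-1)\in\mathcal V_n^\circ,\,J_n(i)\in\mathcal V_n^\star\}$ (the number of steps of the chain obtained by observing $J_n$ at its visits to $\mathcal V_n^\circ$ and at its entrance times into $\mathcal V_n^\star$, needed to make $\lfloor a_nt\rfloor$ visits to $\mathcal V_n^\circ$). *)

theory Defs
  imports "HOL-Probability.Probability" "HOL-Library.Landau_Symbols"
begin

text \<open>A vertex x of {-1,1}^n is encoded by the set of coordinates i < n with x_i = -1.\<close>

definition hcube :: "nat \<Rightarrow> nat set set" where
  "hcube n = Pow {..<n}"

definition hedge :: "nat \<Rightarrow> nat set \<Rightarrow> nat set \<Rightarrow> bool" where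
  "hedge n x y \<longleftrightarrow> x \<in> hcube n \<and> y \<in> hcube n \<and> card ((x - y) \<union> (y - x)) = 1"

definition thr :: "real \<Rightarrow> nat \<Rightarrow> real" where
  "thr cs n = (THE u. measure (density lborel (\<lambda>x. ennreal (std_normal_density x))) {..-u}
                       = real n powr (- cs))"

text \<open>Environment at level n: e x = g(x) for x in V_n.\<close>
definition occ :: "real \<Rightarrow> nat \<Rightarrow> (nat set \<Rightarrow> real) \<Rightarrow> nat set \<Rightarrow> bool" where
  "occ cs n e x \<longleftrightarrow> x \<in> hcube n \<and> e x \<le> - thr cs n"

definition Istar :: "real \<Rightarrow> nat \<Rightarrow> (nat set \<Rightarrow> real) \<Rightarrow> nat set set" where
  "Istar cs n e = {x. occ cs n e x \<and> \<not> (\<exists>y. hedge n x y \<and> occ cs n e y)}"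

definition Vstar :: "real \<Rightarrow> nat \<Rightarrow> (nat set \<Rightarrow> real) \<Rightarrow> nat set set" where
  "Vstar cs n e = {x. occ cs n e x \<and> x \<notin> Istar cs n e}"

definition Vcirc :: "real \<Rightarrow> nat \<Rightarrow> (nat set \<Rightarrow> real) \<Rightarrow> nat set set" where
  "Vcirc cs n e = hcube n - Vstar cs n e"

definition Hn :: "real \<Rightarrow> nat \<Rightarrow> (nat set \<Rightarrow> real) \<Rightarrow> nat set \<Rightarrow> real" where
  "Hn cs n e x = (if occ cs n e x then sqrt (real n) * e x else 0)"

definition ptrans :: "real \<Rightarrow> real \<Rightarrow> nat \<Rightarrow> (nat set \<Rightarrow> real) \<Rightarrow> nat set \<Rightarrow> nat set \<Rightarrow> real" where
  "ptrans beta cs n e x y =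
     (if hedge n x y then
        exp (- beta * max 0 (Hn cs n e y - Hn cs n e x)) /
        (\<Sum>y'\<in>{y'. hedge n x y'}. exp (- beta * max 0 (Hn cs n e y' - Hn cs n e x)))
      else 0)"

definition unif :: "'a set \<Rightarrow> 'a \<Rightarrow> real" where
  "unif A x = (if x \<in> A then 1 / real (card A) else 0)"

definition is_chain :: "'q measure \<Rightarrow> (nat \<Rightarrow> 'q \<Rightarrow> 'a) \<Rightarrow> 'a set \<Rightarrow> ('a \<Rightarrow> real)
                        \<Rightarrow> ('a \<Rightarrow> 'a \<Rightarrow> real) \<Rightarrow> bool" where
  "is_chain Q X V mu p \<longleftrightarrow> prob_space Q \<and>
     (\<forall>i. X i \<in> measurable Q (count_space UNIV)) \<and>
     (\<forall>i q. X i q \<in> V) \<and>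
     (\<forall>k xs. length xs = Suc k \<longrightarrow>
        measure Q {q \<in> space Q. \<forall>i\<le>k. X i q = xs ! i}
          = mu (xs ! 0) * (\<Prod>i<k. p (xs ! i) (xs ! Suc i)))"

definition kcirc :: "(nat \<Rightarrow> real) \<Rightarrow> real \<Rightarrow> nat \<Rightarrow> nat" where
  "kcirc a t n = nat \<lfloor>a n * t\<rfloor>"

definition Kn :: "nat set set \<Rightarrow> nat \<Rightarrow> (nat \<Rightarrow> nat set) \<Rightarrow> nat" where
  "Kn Vc m w = (LEAST k. 1 \<le> k \<and> (\<Sum>i<k. if w i \<in> Vc then 1 else 0) = (m::nat))"

definition kdag :: "nat set set \<Rightarrow> nat set set \<Rightarrow> nat \<Rightarrow> (nat \<Rightarrow> nat set) \<Rightarrow> nat" where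
  "kdag Vc Vs m w = m + card {i. 1 \<le> i \<and> i \<le> Kn Vc m w - 1 \<and> w (i - 1) \<in> Vc \<and> w i \<in> Vs}"

end

theory Submission
  imports Defs "HOL-Real_Asymp.Real_Asymp"
begin

text \<open>
  The jump chain is reversible: \<open>p(x,y)\<close> is proportional to the symmetric conductance
  \<open>exp (-\<beta> max (H x) (H y))\<close>, so the total conductance \<open>\<pi>\<close> is invariant. On
  \<open>V\<^sup>\<circ>\<close> every edge has conductance 1, so \<open>\<pi> = n\<close> there and the uniform law on
  \<open>V\<^sup>\<circ>\<close> is dominated by \<open>\<rho> = \<pi> / (n |V\<^sup>\<circ>|)\<close>. Invariance then gives, by induction
  on time, that between the \<open>j\<close>-th and the next visit to \<open>V\<^sup>\<circ>\<close> the expected number of visits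
  to \<open>y\<close> is at most \<open>\<rho> y\<close>. Hence the expected number of entrances into \<open>V\<^sup>\<star>\<close> during
  the first \<open>m\<close> visits to \<open>V\<^sup>\<circ>\<close> is at most \<open>m |V\<^sup>\<star>| / |V\<^sup>\<circ>|\<close>, and Markov's
  inequality applies.

  A vertex of \<open>V\<^sup>\<star>\<close> is an endpoint of an edge with both ends occupied. Chebyshev's inequality
  in each of the \<open>n\<close> directions and the Borel-Cantelli lemma give
  \<open>|V\<^sup>\<star>| \<le> 2 n\<^bsup>1 - 2c\<^esup> 2\<^sup>n\<close> for almost all \<open>n\<close>. This is smaller
  by a factor of order \<open>n\<close> than needed, so the error term \<open>f\<close> can be taken to be zero.
\<close>

section \<open>Chains with a subinvariant weight\<close>

definition visits :: "'a set \<Rightarrow> (nat \<Rightarrow> 'a) \<Rightarrow> nat \<Rightarrow> nat" where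
  "visits C w k = (\<Sum>i<k. if w i \<in> C then 1 else 0)"

lemma visits_0 [simp]: "visits C w 0 = 0"
  by (simp add: visits_def)

lemma visits_Suc: "visits C w (Suc k) = visits C w k + (if w k \<in> C then 1 else 0)"
  by (simp add: visits_def)

lemma visits_cong: "(\<And>i. i < k \<Longrightarrow> w i = w' i) \<Longrightarrow> visits C w k = visits C w' k"
  by (simp add: visits_def)

lemma visits_pos: "w 0 \<in> C \<Longrightarrow> 0 < visits C w (Suc k)"
  by (induction k) (auto simp: visits_Suc)

text \<open>Discrete intermediate value: the count starts at 0 and grows by at most 1 per
  step.\<close>

lemma visits_attains:
  assumes "m \<le> visits C w i"
  shows "\<exists>k\<le>i. visits C w k = m"
  using assms
proof (induction i)
  case (Suc i)
  show ?case
  proof (cases "m \<le> visits C w i")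
    case True
    with Suc.IH show ?thesis by (meson le_SucI)
  next
    case False
    with Suc.prems show ?thesis by (auto intro!: exI[of _ "Suc i"] simp: visits_Suc split: if_splits)
  qed
qed auto

lemma Kn_visits: "Kn C m w = (LEAST k. 1 \<le> k \<and> visits C w k = m)"
  by (simp add: Kn_def visits_def)

text \<open>If the count had reached \<open>m\<close> by time \<open>i\<close>, some
  \<open>k \<le> i\<close> would satisfy the predicate under \<open>LEAST\<close>, forcing
  \<open>Kn\<close> down to \<open>k\<close>. This also covers paths with fewer than
  \<open>m\<close> visits, where \<open>Kn\<close> is a default value.\<close>

lemma visits_less_Kn:
  assumes "1 \<le> m" "1 \<le> i" "i \<le> Kn C m w - 1"
  shows "visits C w i < m"
proof (rule ccontr)
  assume "\<not> visits C w i < m"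
  then obtain k where k: "k \<le> i" "visits C w k = m"
    using visits_attains[of m C w i] by auto
  with assms(1) have "1 \<le> k" by (cases k) auto
  with k have "Kn C m w \<le> k" unfolding Kn_visits by (intro Least_le) auto
  with k assms show False by linarith
qed

section \<open>Finite-state chains given by their path probabilities\<close>

locale finite_chain =
  fixes Q :: "'q measure" and X :: "nat \<Rightarrow> 'q \<Rightarrow> 'a" and V :: "'a set"
    and mu :: "'a \<Rightarrow> real" and p :: "'a \<Rightarrow> 'a \<Rightarrow> real"
  assumes chain: "is_chain Q X V mu p" and finV: "finite V"
begin

sublocale prob_space Q
  using chain by (simp add: is_chain_def)

lemma X_meas [measurable]: "X i \<in> measurable Q (count_space UNIV)"
  using chain by (simp add: is_chain_def)

lemma X_in: "X i q \<in> V"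
  using chain by (simp add: is_chain_def)

lemma prob_path:
  "length xs = Suc k \<Longrightarrow> prob {q \<in> space Q. \<forall>i\<le>k. X i q = xs ! i}
     = mu (xs ! 0) * (\<Prod>i<k. p (xs ! i) (xs ! Suc i))"
  using chain by (simp add: is_chain_def)

lemma prob_init: "prob {q \<in> space Q. X 0 q = x} = mu x"
  using prob_path[of "[x]" 0] by simp

text \<open>\<open>is_chain\<close> only prescribes the probabilities of full paths. The event about
  the past is therefore cut into cylinders, one for each of the finitely many admissible paths;
  extending a path by \<open>y\<close> multiplies its probability by the last transition
  factor.\<close>

lemma markov_property:
  assumes R: "\<And>w w'. (\<And>i. i \<le> k \<Longrightarrow> w i = w' i) \<Longrightarrow> R w = R w'"
  shows "prob {q \<in> space Q. R (\<lambda>i. X i q) \<and> X k q = x \<and> X (Suc k) q = y}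
         = prob {q \<in> space Q. R (\<lambda>i. X i q) \<and> X k q = x} * p x y"
proof -
  define T where "T = {xs. set xs \<subseteq> V \<and> length xs = Suc k \<and> R (\<lambda>i. xs ! i) \<and> xs ! k = x}"
  have "finite T"
    by (rule finite_subset[OF _ finite_lists_length_eq[OF finV, of "Suc k"]]) (auto simp: T_def)
  have lenT: "length xs = Suc k" if "xs \<in> T" for xs using that by (simp add: T_def)
  have path: "\<exists>xs\<in>T. \<forall>i\<le>k. X i q = xs ! i" if "R (\<lambda>i. X i q)" "X k q = x" for q
  proof (rule bexI[of _ "map (\<lambda>i. X i q) [0..<Suc k]"])
    show "\<forall>i\<le>k. X i q = map (\<lambda>i. X i q) [0..<Suc k] ! i"
      by (simp del: upt_Suc)
    have "R (\<lambda>i. map (\<lambda>i. X i q) [0..<Suc k] ! i) = R (\<lambda>i. X i q)"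
      by (rule R) (simp del: upt_Suc)
    with that show "map (\<lambda>i. X i q) [0..<Suc k] \<in> T"
      by (auto simp: T_def X_in simp del: upt_Suc)
  qed
  have conv: "R (\<lambda>i. X i q) \<and> X k q = x" if "xs \<in> T" "\<forall>i\<le>k. X i q = xs ! i" for xs q
    using that R[of "\<lambda>i. X i q" "\<lambda>i. xs ! i"] by (auto simp: T_def)
  have eqT: "xs = ys" if "xs \<in> T" "ys \<in> T" "\<forall>i\<le>k. X i q = xs ! i" "\<forall>i\<le>k. X i q = ys ! i" for xs ys q
    using that by (intro nth_equalityI) (auto simp: T_def less_Suc_eq_le)
  define E where "E xs = {q \<in> space Q. \<forall>i\<le>k. X i q = xs ! i}" for xs
  define F where "F xs = {q \<in> space Q. \<forall>i\<le>Suc k. X i q = (xs @ [y]) ! i}" for xs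
  have EF: "F xs = E xs \<inter> {q \<in> space Q. X (Suc k) q = y}" if "xs \<in> T" for xs
    using lenT[OF that] by (auto simp: E_def F_def nth_append le_Suc_eq)
  have [measurable]: "E xs \<in> sets Q" "F xs \<in> sets Q" for xs
    unfolding E_def F_def by measurable
  have disj: "disjoint_family_on E T"
    by (auto simp: disjoint_family_on_def E_def dest: eqT)
  have disjF: "disjoint_family_on F T"
    using disj by (auto simp: disjoint_family_on_def EF)
  have 1: "{q \<in> space Q. R (\<lambda>i. X i q) \<and> X k q = x} = (\<Union>xs\<in>T. E xs)"
    using path conv by (fastforce simp: E_def)
  then have 2: "{q \<in> space Q. R (\<lambda>i. X i q) \<and> X k q = x \<and> X (Suc k) q = y} = (\<Union>xs\<in>T. F xs)"
    by (auto simp: EF)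
  have "prob (F xs) = prob (E xs) * p x y" if "xs \<in> T" for xs
  proof -
    have len: "length xs = Suc k" and last: "xs ! k = x" using that by (auto simp: T_def)
    have "prob (F xs) = mu (xs ! 0) * (\<Prod>i<Suc k. p ((xs @ [y]) ! i) ((xs @ [y]) ! Suc i))"
      unfolding F_def using prob_path[of "xs @ [y]" "Suc k"] len by (simp add: nth_append)
    also have "(\<Prod>i<Suc k. p ((xs @ [y]) ! i) ((xs @ [y]) ! Suc i))
       = (\<Prod>i<k. p (xs ! i) (xs ! Suc i)) * p x y"
      using len last by (simp add: nth_append)
    finally show ?thesis unfolding E_def using prob_path[OF len] by simp
  qed
  then show ?thesis
    unfolding 1 2 using \<open>finite T\<close> disj disjF
    by (subst (1 2) finite_measure_finite_Union) (auto simp: sum_distrib_right)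
qed

lemma prob_step:
  assumes R: "\<And>w w'. (\<And>i. i \<le> k \<Longrightarrow> w i = w' i) \<Longrightarrow> R w = R w'"
    and [measurable]: "Measurable.pred Q (\<lambda>q. R (\<lambda>i. X i q))"
  shows "prob {q \<in> space Q. R (\<lambda>i. X i q) \<and> X (Suc k) q = y}
         = (\<Sum>x\<in>V. prob {q \<in> space Q. R (\<lambda>i. X i q) \<and> X k q = x} * p x y)"
proof -
  have "{q \<in> space Q. R (\<lambda>i. X i q) \<and> X (Suc k) q = y}
      = (\<Union>x\<in>V. {q \<in> space Q. R (\<lambda>i. X i q) \<and> X k q = x \<and> X (Suc k) q = y})"
    using X_in by auto
  then have "prob {q \<in> space Q. R (\<lambda>i. X i q) \<and> X (Suc k) q = y}
      = (\<Sum>x\<in>V. prob {q \<in> space Q. R (\<lambda>i. X i q) \<and> X k q = x \<and> X (Suc k) q = y})"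
    by (simp only:) (rule finite_measure_finite_Union, use finV in \<open>auto simp: disjoint_family_on_def\<close>)
  also have "\<dots> = (\<Sum>x\<in>V. prob {q \<in> space Q. R (\<lambda>i. X i q) \<and> X k q = x} * p x y)"
    by (intro sum.cong refl markov_property R)
  finally show ?thesis .
qed

lemma X_in_meas [measurable]: "Measurable.pred Q (\<lambda>q. X i q \<in> A)"
  using measurable_compose[OF X_meas, of "\<lambda>x. x \<in> A"] by simp

lemma visits_meas [measurable]: "(\<lambda>q. visits C (\<lambda>i. X i q) k) \<in> measurable Q (count_space UNIV)"
  unfolding visits_def by measurable

end

locale subinvariant_chain = finite_chain Q X V mu p
  for Q :: "'q measure" and X :: "nat \<Rightarrow> 'q \<Rightarrow> 'a" and V mu p +
  fixes C :: "'a set" and \<rho> :: "'a \<Rightarrow> real"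
  assumes p_nonneg: "\<And>x y. 0 \<le> p x y"
    and subinv: "\<And>y. y \<in> V \<Longrightarrow> (\<Sum>x\<in>V. \<rho> x * p x y) \<le> \<rho> y"
    and \<rho>_nonneg: "\<And>x. x \<in> V \<Longrightarrow> 0 \<le> \<rho> x"
    and mu_le: "\<And>x. x \<in> C \<Longrightarrow> mu x \<le> \<rho> x"
    and mu_out: "\<And>x. x \<notin> C \<Longrightarrow> mu x = 0"
begin

lemma prob_start_outside: "prob {q \<in> space Q. X 0 q \<notin> C} = 0"
proof -
  have "{q \<in> space Q. X 0 q \<notin> C} = (\<Union>x\<in>V - C. {q \<in> space Q. X 0 q = x})"
    using X_in by auto
  then have "prob {q \<in> space Q. X 0 q \<notin> C} = (\<Sum>x\<in>V - C. prob {q \<in> space Q. X 0 q = x})"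
    by (simp only:) (rule finite_measure_finite_Union, use finV in \<open>auto simp: disjoint_family_on_def\<close>)
  then show ?thesis by (simp add: prob_init mu_out)
qed

lemma prob_le_subinvariant: "y \<in> V \<Longrightarrow> prob {q \<in> space Q. X k q = y} \<le> \<rho> y"
proof (induction k arbitrary: y)
  case 0
  then show ?case
    using mu_le[of y] mu_out[of y] \<rho>_nonneg[of y] by (cases "y \<in> C") (auto simp: prob_init)
next
  case (Suc k)
  have "prob {q \<in> space Q. X (Suc k) q = y} = (\<Sum>x\<in>V. prob {q \<in> space Q. X k q = x} * p x y)"
    using prob_step[of k "\<lambda>_. True" y] by simp
  also have "\<dots> \<le> (\<Sum>x\<in>V. \<rho> x * p x y)"
    by (intro sum_mono mult_right_mono Suc.IH p_nonneg)
  also have "\<dots> \<le> \<rho> y" using subinv Suc.prems .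
  finally show ?case .
qed

text \<open>The count up to \<open>Suc k\<close> includes time \<open>k\<close>, so the event places
  time \<open>k\<close> in the stretch from visit number \<open>Suc j\<close> to \<open>C\<close>
  until just before the next one. By decomposition of the last step, \<open>y\<close> is reached
  from the same stretch if it lies outside \<open>C\<close> and from the previous stretch if it lies
  in \<open>C\<close>. Either way subinvariance closes the induction on \<open>L\<close>, run for
  all \<open>j\<close> and \<open>y\<close> at once.\<close>

lemma expected_visits_le:
  "y \<in> V \<Longrightarrow> (\<Sum>k\<le>L. prob {q \<in> space Q. visits C (\<lambda>i. X i q) (Suc k) = Suc j \<and> X k q = y}) \<le> \<rho> y"
proof (induction L arbitrary: j y)
  case 0
  have "prob {q \<in> space Q. visits C (\<lambda>i. X i q) (Suc 0) = Suc j \<and> X 0 q = y} \<le> prob {q \<in> space Q. X 0 q = y}"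
    by (intro finite_measure_mono) auto
  also have "\<dots> \<le> \<rho> y" using 0 by (rule prob_le_subinvariant)
  finally show ?case by simp
next
  case (Suc L)
  let ?vis = "\<lambda>q k. visits C (\<lambda>i. X i q) k"
  have step: "prob {q \<in> space Q. ?vis q (Suc k) = i \<and> X (Suc k) q = y}
      = (\<Sum>x\<in>V. prob {q \<in> space Q. ?vis q (Suc k) = i \<and> X k q = x} * p x y)" for k i
    by (rule prob_step[of k "\<lambda>w. visits C w (Suc k) = i"]) 
      (auto intro!: arg_cong2[where f="(=)"] visits_cong)
  \<comment> \<open>The induction hypothesis bounds the occupation of each predecessor
    \<open>x\<close> by \<open>\<rho> x\<close>, and one step maps \<open>\<rho>\<close> below
    itself.\<close>
  have IH: "(\<Sum>k\<le>L. prob {q \<in> space Q. ?vis q (Suc k) = Suc i \<and> X (Suc k) q = y}) \<le> \<rho> y" for i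
  proof -
    have "(\<Sum>k\<le>L. prob {q \<in> space Q. ?vis q (Suc k) = Suc i \<and> X (Suc k) q = y})
      = (\<Sum>x\<in>V. (\<Sum>k\<le>L. prob {q \<in> space Q. ?vis q (Suc k) = Suc i \<and> X k q = x}) * p x y)"
      unfolding step by (subst sum.swap) (simp add: sum_distrib_right)
    also have "\<dots> \<le> (\<Sum>x\<in>V. \<rho> x * p x y)"
      by (intro sum_mono mult_right_mono Suc.IH p_nonneg)
    also have "\<dots> \<le> \<rho> y" using subinv Suc.prems .
    finally show ?thesis .
  qed
  have split: "(\<Sum>k\<le>Suc L. prob {q \<in> space Q. ?vis q (Suc k) = Suc j \<and> X k q = y})
    = prob {q \<in> space Q. ?vis q (Suc 0) = Suc j \<and> X 0 q = y}
      + (\<Sum>k\<le>L. prob {q \<in> space Q. ?vis q (Suc (Suc k)) = Suc j \<and> X (Suc k) q = y})"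
    by (rule sum.atMost_Suc_shift)
  show ?case
  proof (cases "y \<in> C")
    case False
    \<comment> \<open>Starting outside \<open>C\<close> gives count 0, and moving to
      \<open>y\<close> leaves the count unchanged.\<close>
    then have none: "{q \<in> space Q. ?vis q (Suc 0) = Suc j \<and> X 0 q = y} = {}" by (auto simp: visits_Suc)
    have same: "{q \<in> space Q. ?vis q (Suc (Suc k)) = Suc j \<and> X (Suc k) q = y}
       = {q \<in> space Q. ?vis q (Suc k) = Suc j \<and> X (Suc k) q = y}" for k
      using False by (auto simp: visits_Suc[of _ _ "Suc k"])
    show ?thesis unfolding split none same using IH[of j] by simp
  next
    case True
    then have *: "{q \<in> space Q. ?vis q (Suc (Suc k)) = Suc j \<and> X (Suc k) q = y}
       = {q \<in> space Q. ?vis q (Suc k) = j \<and> X (Suc k) q = y}" for k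
      by (auto simp: visits_Suc[of _ _ "Suc k"])
    show ?thesis
    \<comment> \<open>For \<open>j = 0\<close> a later term would need no visit to \<open>C\<close>
      so far, which has probability 0, so only time 0 remains; for \<open>j = Suc i\<close> the
      time-0 term vanishes instead.\<close>
    proof (cases j)
      case 0
      have "prob {q \<in> space Q. ?vis q (Suc k) = 0 \<and> X (Suc k) q = y} = 0" for k
      proof -
        have "prob {q \<in> space Q. ?vis q (Suc k) = 0 \<and> X (Suc k) q = y} \<le> prob {q \<in> space Q. X 0 q \<notin> C}"
          by (intro finite_measure_mono) (auto dest: visits_pos[where k=k])
        then show ?thesis unfolding prob_start_outside by (simp add: antisym)
      qed
      moreover have "prob {q \<in> space Q. ?vis q (Suc 0) = Suc j \<and> X 0 q = y} \<le> prob {q \<in> space Q. X 0 q = y}"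
        by (intro finite_measure_mono) auto
      moreover have "\<dots> \<le> \<rho> y" using Suc.prems by (rule prob_le_subinvariant)
      ultimately show ?thesis unfolding split * using 0 by simp
    next
      case (Suc i)
      then have none: "{q \<in> space Q. ?vis q (Suc 0) = Suc j \<and> X 0 q = y} = {}" by (auto simp: visits_Suc)
      show ?thesis unfolding split * none using IH[of i] Suc by simp
    qed
  qed
qed

end

section \<open>Entrances into a target set\<close>

lemma (in prob_space) prob_card_ge:
  assumes "finite I" "\<And>i. i \<in> I \<Longrightarrow> E i \<in> events" "0 < c"
  shows "prob {q \<in> space M. c \<le> real (card {i \<in> I. q \<in> E i})} \<le> (\<Sum>i\<in>I. prob (E i)) / c"
proof -
  have card: "real (card {i \<in> I. q \<in> E i}) = (\<Sum>i\<in>I. indicator (E i) q)" for q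
    using assms(1) by (simp add: indicator_def sum.If_cases Int_def)
  have int: "integrable M (\<lambda>q. \<Sum>i\<in>I. indicator (E i) q :: real)"
    using assms by (intro Bochner_Integration.integrable_sum) (auto simp: emeasure_eq_measure)
  have "prob {q \<in> space M. c \<le> (\<Sum>i\<in>I. indicator (E i) q :: real)}
      \<le> (\<integral>q. (\<Sum>i\<in>I. indicator (E i) q) \<partial>M) / c"
    using int assms(3) by (intro integral_Markov_inequality_measure[where A="{}"]) (auto intro!: AE_I2 sum_nonneg)
  also have "(\<integral>q. (\<Sum>i\<in>I. indicator (E i) q :: real) \<partial>M) = (\<Sum>i\<in>I. prob (E i))"
    using assms by (subst Bochner_Integration.integral_sum) (auto simp: emeasure_eq_measure)
  finally show ?thesis by (simp add: card)
qed

context subinvariant_chain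
begin

definition flux :: "'a set \<Rightarrow> real" where
  "flux S = (\<Sum>x\<in>C. \<Sum>y\<in>S. \<rho> x * p x y)"

lemma flux_nonneg: "C \<subseteq> V \<Longrightarrow> 0 \<le> flux S"
  unfolding flux_def by (intro sum_nonneg mult_nonneg_nonneg) (auto intro: \<rho>_nonneg p_nonneg)

text \<open>Bounds an entrance at one fixed time. It serves the degenerate case of zero visits,
  where entrances are summed over a fixed number of times.\<close>

lemma prob_entry_le:
  assumes CV: "C \<subseteq> V" and S: "S \<subseteq> V"
  shows "prob {q \<in> space Q. X i q \<in> C \<and> X (Suc i) q \<in> S} \<le> flux S"
proof -
  note fin = finite_subset[OF CV finV] finite_subset[OF S finV]
  have "{q \<in> space Q. X i q \<in> C \<and> X (Suc i) q \<in> S}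
     = (\<Union>(x,y)\<in>C \<times> S. {q \<in> space Q. True \<and> X i q = x \<and> X (Suc i) q = y})" by auto
  then have "prob {q \<in> space Q. X i q \<in> C \<and> X (Suc i) q \<in> S}
     \<le> (\<Sum>(x,y)\<in>C \<times> S. prob {q \<in> space Q. True \<and> X i q = x \<and> X (Suc i) q = y})"
    using finite_measure_subadditive_finite[of "C \<times> S" "\<lambda>(x,y). {q \<in> space Q. True \<and> X i q = x \<and> X (Suc i) q = y}"] fin
    by (auto simp: case_prod_beta image_subset_iff)
  also have "\<dots> = (\<Sum>x\<in>C. \<Sum>y\<in>S. prob {q \<in> space Q. True \<and> X i q = x} * p x y)"
    using markov_property[of i "\<lambda>_. True"] by (simp add: sum.cartesian_product)
  also have "\<dots> \<le> flux S"
    unfolding flux_def using CV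
    by (intro sum_mono mult_right_mono p_nonneg) (auto intro: prob_le_subinvariant)
  finally show ?thesis .
qed

text \<open>Entrances are sorted by the index \<open>Suc j \<le> m\<close> of the visit to
  \<open>C\<close> from which they leave. By the Markov property and the occupation bound for that
  stretch, each of the \<open>m\<close> indices contributes at most \<open>flux S\<close>, whatever
  the horizon \<open>L\<close>.\<close>

lemma expected_entries_le:
  assumes CV: "C \<subseteq> V" and S: "S \<subseteq> V"
  shows "(\<Sum>i\<le>L. prob {q \<in> space Q. visits C (\<lambda>i. X i q) (Suc i) \<le> m \<and> X i q \<in> C \<and> X (Suc i) q \<in> S})
     \<le> real m * flux S"
proof -
  note fin = finite_subset[OF CV finV] finite_subset[OF S finV]
  let ?vis = "\<lambda>q k. visits C (\<lambda>i. X i q) k"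
  let ?E = "\<lambda>i (j, x, y). {q \<in> space Q. ?vis q (Suc i) = Suc j \<and> X i q = x \<and> X (Suc i) q = y}"
  let ?I = "{..<m} \<times> C \<times> S"
  have mk: "prob (?E i (j, x, y)) = prob {q \<in> space Q. ?vis q (Suc i) = Suc j \<and> X i q = x} * p x y" for i j x y
    unfolding prod.case
    by (rule markov_property[of i "\<lambda>w. visits C w (Suc i) = Suc j"])
      (auto intro!: arg_cong2[where f="(=)"] visits_cong)
  have "prob {q \<in> space Q. ?vis q (Suc i) \<le> m \<and> X i q \<in> C \<and> X (Suc i) q \<in> S}
      \<le> (\<Sum>z\<in>?I. prob (?E i z))" for i
  proof -
    have "{q \<in> space Q. ?vis q (Suc i) \<le> m \<and> X i q \<in> C \<and> X (Suc i) q \<in> S} \<subseteq> (\<Union>z\<in>?I. ?E i z)"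
    proof
      fix q assume q: "q \<in> {q \<in> space Q. ?vis q (Suc i) \<le> m \<and> X i q \<in> C \<and> X (Suc i) q \<in> S}"
      then have "?vis q (Suc i) = Suc (?vis q i)" by (simp add: visits_Suc)
      with q have "(?vis q i, X i q, X (Suc i) q) \<in> ?I" "q \<in> ?E i (?vis q i, X i q, X (Suc i) q)" by auto
      then show "q \<in> (\<Union>z\<in>?I. ?E i z)" by blast
    qed
    then have "prob {q \<in> space Q. ?vis q (Suc i) \<le> m \<and> X i q \<in> C \<and> X (Suc i) q \<in> S} \<le> prob (\<Union>z\<in>?I. ?E i z)"
      using fin by (intro finite_measure_mono sets.finite_UN) (auto simp: case_prod_beta)
    also have "\<dots> \<le> (\<Sum>z\<in>?I. prob (?E i z))"
      using fin by (intro finite_measure_subadditive_finite) (auto simp: case_prod_beta)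
    finally show ?thesis .
  qed
  then have "(\<Sum>i\<le>L. prob {q \<in> space Q. ?vis q (Suc i) \<le> m \<and> X i q \<in> C \<and> X (Suc i) q \<in> S})
     \<le> (\<Sum>i\<le>L. \<Sum>z\<in>?I. prob (?E i z))" by (rule sum_mono)
  also have "\<dots> = (\<Sum>(j,x,y)\<in>?I. (\<Sum>i\<le>L. prob {q \<in> space Q. ?vis q (Suc i) = Suc j \<and> X i q = x}) * p x y)"
    by (subst sum.swap) (auto intro!: sum.cong simp: mk[unfolded prod.case] sum_distrib_right)
  also have "\<dots> \<le> (\<Sum>(j,x,y)\<in>?I. \<rho> x * p x y)"
    using CV by (intro sum_mono) (auto intro!: mult_right_mono p_nonneg expected_visits_le)
  also have "\<dots> = (\<Sum>j<m. \<Sum>x\<in>C. \<Sum>y\<in>S. \<rho> x * p x y)"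
    by (simp only: sum.cartesian_product)
  also have "\<dots> = real m * flux S" by (simp add: flux_def)
  finally show ?thesis .
qed

text \<open>The bound does not require the chain to return to \<^term>\<open>C\<close>: if it makes fewer than
  \<^term>\<open>Suc m\<close> visits, all its entrances into \<^term>\<open>S\<close> are counted.\<close>

lemma prob_entries_gt:
  assumes CV: "C \<subseteq> V" and S: "S \<subseteq> V" and c: "0 < c"
  shows "prob {q \<in> space Q. \<exists>L. c \<le> real (card {i\<in>{..L}. visits C (\<lambda>i. X i q) (Suc i) \<le> m \<and> X i q \<in> C \<and> X (Suc i) q \<in> S})}
    \<le> real m * flux S / c"
proof -
  let ?N = "\<lambda>L q. {i\<in>{..L}. visits C (\<lambda>i. X i q) (Suc i) \<le> m \<and> X i q \<in> C \<and> X (Suc i) q \<in> S}"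
  let ?A = "\<lambda>L. {q \<in> space Q. c \<le> real (card (?N L q))}"
  have [measurable]: "?A L \<in> events" for L by measurable
  \<comment> \<open>The bound is uniform in \<open>L\<close>, so continuity from below carries it to
    an unlimited horizon.\<close>
  have "incseq ?A"
  proof (rule incseq_SucI)
    fix L
    have "real (card (?N L q)) \<le> real (card (?N (Suc L) q))" for q
      by (intro of_nat_mono card_mono) auto
    then show "?A L \<subseteq> ?A (Suc L)" by (auto intro: order.trans)
  qed
  then have "(\<lambda>L. prob (?A L)) \<longlonglongrightarrow> prob (\<Union>L. ?A L)"
    by (intro finite_Lim_measure_incseq) auto
  moreover have "prob (?A L) \<le> real m * flux S / c" for L
  proof -
    have "prob (?A L) = prob {q \<in> space Q. c \<le> real (card {i\<in>{..L}. q \<in> {q \<in> space Q. visits C (\<lambda>i. X i q) (Suc i) \<le> m \<and> X i q \<in> C \<and> X (Suc i) q \<in> S}})}"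
      by (intro arg_cong[where f=prob]) auto
    also have "\<dots> \<le> (\<Sum>i\<le>L. prob {q \<in> space Q. visits C (\<lambda>i. X i q) (Suc i) \<le> m \<and> X i q \<in> C \<and> X (Suc i) q \<in> S}) / c"
      using c by (intro prob_card_ge) auto
    also have "\<dots> \<le> real m * flux S / c"
      using c by (intro divide_right_mono expected_entries_le CV S) auto
    finally show ?thesis .
  qed
  ultimately have "prob (\<Union>L. ?A L) \<le> real m * flux S / c"
    by (intro LIMSEQ_le_const2) auto
  moreover have "(\<Union>L. ?A L) = {q \<in> space Q. \<exists>L. c \<le> real (card (?N L q))}" by auto
  ultimately show ?thesis by simp
qed

end

section \<open>From entrance counts to \<open>kdag\<close>\<close>

lemma kdag_ge: "m \<le> kdag Vc Vs m w"
  by (simp add: kdag_def)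

lemma kdag_meas:
  assumes [measurable]: "\<And>i. X i \<in> measurable Q (count_space UNIV)"
  shows "(\<lambda>q. kdag C S m (\<lambda>i. X i q)) \<in> measurable Q (count_space UNIV)"
proof -
  have [measurable]: "Measurable.pred Q (\<lambda>q. X i q \<in> A)" for i A
    using measurable_compose[OF assms, of "\<lambda>x. x \<in> A"] by simp
  have [measurable]: "(\<lambda>q. Kn C m (\<lambda>i. X i q)) \<in> measurable Q (count_space UNIV)"
    unfolding Kn_def by measurable
  show ?thesis unfolding kdag_def by measurable
qed

text \<open>An entrance at time \<open>i\<close> is reindexed by the time \<open>i - 1\<close> of
  the visit it leaves; before \<open>Kn\<close> fewer than \<open>m\<close> visits have been made,
  hence the bound \<open>m - 1\<close>. The horizon is existential because the witness
  \<open>Kn\<close> depends on the path.\<close>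

lemma kdag_le_entries:
  assumes "1 \<le> m"
  shows "\<exists>L. kdag C S m w \<le> m + card {i\<in>{..L}. visits C w (Suc i) \<le> m - 1 \<and> w i \<in> C \<and> w (Suc i) \<in> S}"
proof -
  let ?K = "Kn C m w"
  let ?A = "{i\<in>{..?K}. visits C w (Suc i) \<le> m - 1 \<and> w i \<in> C \<and> w (Suc i) \<in> S}"
  have "{i. 1 \<le> i \<and> i \<le> ?K - 1 \<and> w (i - 1) \<in> C \<and> w i \<in> S} \<subseteq> Suc ` ?A"
  proof
    fix i assume i: "i \<in> {i. 1 \<le> i \<and> i \<le> ?K - 1 \<and> w (i - 1) \<in> C \<and> w i \<in> S}"
    then have "visits C w i < m" using assms visits_less_Kn by auto
    with i have "i - 1 \<in> ?A" "i = Suc (i - 1)" by auto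
    then show "i \<in> Suc ` ?A" by blast
  qed
  then have "card {i. 1 \<le> i \<and> i \<le> ?K - 1 \<and> w (i - 1) \<in> C \<and> w i \<in> S} \<le> card (Suc ` ?A)"
    by (intro card_mono) auto
  also have "\<dots> = card ?A" by (intro card_image) auto
  finally show ?thesis unfolding kdag_def by (intro exI[of _ ?K]) simp
qed

text \<open>A path started in \<^term>\<open>C\<close> never has zero visits, so \<^term>\<open>Kn C 0 w\<close> is the junk value
  of \<open>LEAST\<close> on the empty predicate; it does not depend on the path.\<close>

lemma Kn_zero: "w 0 \<in> C \<Longrightarrow> Kn C 0 w = (LEAST k. False)"
proof -
  assume "w 0 \<in> C"
  then have "(1 \<le> k \<and> visits C w k = 0) = False" for k
    using visits_pos[of w C "k - 1"] by (cases k) auto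
  then show ?thesis unfolding Kn_visits by (simp only:)
qed

text \<open>Markov's inequality with threshold \<open>\<delta> * real m\<close> against an
  expectation of at most \<open>m\<close> times the flux: \<open>m\<close> cancels, so the bound is
  uniform in \<open>m\<close>. The hypothesis \<open>small\<close> serves \<open>m = 0\<close>,
  where the ratio condition forbids every entrance before the default value of
  \<open>Kn\<close>.\<close>

lemma kdag_ratio_prob:
  fixes X :: "nat \<Rightarrow> 'q \<Rightarrow> nat set"
  assumes "subinvariant_chain Q X V mu p C \<rho>" and CV: "C \<subseteq> V" and S: "S \<subseteq> V" and "0 < \<delta>"
    and small: "real (LEAST k. False) * \<delta> \<le> 1"
  shows "measure Q {q \<in> space Q. real m \<le> real (kdag C S m (\<lambda>i. X i q))
           \<and> real (kdag C S m (\<lambda>i. X i q)) \<le> (1 + \<delta>) * real m}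
        \<ge> 1 - (\<Sum>x\<in>C. \<Sum>y\<in>S. \<rho> x * p x y) / \<delta>"
proof -
  interpret subinvariant_chain Q X V mu p C \<rho> by fact
  have [measurable]: "(\<lambda>q. kdag C S m (\<lambda>i. X i q)) \<in> measurable Q (count_space UNIV)"
    by (intro kdag_meas X_meas)
  let ?good = "{q \<in> space Q. real m \<le> real (kdag C S m (\<lambda>i. X i q))
           \<and> real (kdag C S m (\<lambda>i. X i q)) \<le> (1 + \<delta>) * real m}"
  let ?bad = "{q \<in> space Q. \<not> real (kdag C S m (\<lambda>i. X i q)) \<le> (1 + \<delta>) * real m}"
  have "?good = space Q - ?bad" using kdag_ge[of m C S] by auto
  then have good: "prob ?good = 1 - prob ?bad"
    by (simp add: prob_compl)
  have "prob ?bad \<le> flux S / \<delta>"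
  proof (cases "m = 0")
    case False
    let ?B = "{q \<in> space Q. \<exists>L. \<delta> * real m \<le> real (card {i\<in>{..L}. visits C (\<lambda>i. X i q) (Suc i) \<le> m - 1 \<and> X i q \<in> C \<and> X (Suc i) q \<in> S})}"
    have "?bad \<subseteq> ?B"
    proof safe
      fix q assume "\<not> real (kdag C S m (\<lambda>i. X i q)) \<le> (1 + \<delta>) * real m"
      moreover obtain L where "kdag C S m (\<lambda>i. X i q) \<le> m + card {i\<in>{..L}. visits C (\<lambda>i. X i q) (Suc i) \<le> m - 1 \<and> X i q \<in> C \<and> X (Suc i) q \<in> S}"
        using kdag_le_entries[of m C S "\<lambda>i. X i q"] False by auto
      ultimately show "\<exists>L. \<delta> * real m \<le> real (card {i\<in>{..L}. visits C (\<lambda>i. X i q) (Suc i) \<le> m - 1 \<and> X i q \<in> C \<and> X (Suc i) q \<in> S})"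
        by (intro exI[of _ L]) (simp add: algebra_simps)
    qed
    then have "prob ?bad \<le> prob ?B" by (intro finite_measure_mono) measurable
    also have "\<dots> \<le> real (m - 1) * flux S / (\<delta> * real m)"
      using False \<open>0 < \<delta>\<close> by (intro prob_entries_gt CV S) auto
    also have "\<dots> \<le> real m * flux S / (\<delta> * real m)"
      using \<open>0 < \<delta>\<close> flux_nonneg[OF CV] by (intro divide_right_mono mult_right_mono) auto
    also have "\<dots> = flux S / \<delta>" using False by simp
    finally show ?thesis .
  next
    case True
    \<comment> \<open>Off the null event of starting outside \<open>C\<close>, a positive
      \<open>kdag\<close> requires an entrance before the fixed time \<open>k0\<close>. The union
      bound costs \<open>k0 * flux S\<close>, and \<open>small\<close> gives
      \<open>k0 \<le> 1 / \<delta>\<close>.\<close>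
    define k0 :: nat where "k0 = (LEAST k. False)"
    let ?E = "\<lambda>i. {q \<in> space Q. X i q \<in> C \<and> X (Suc i) q \<in> S}"
    have "?bad \<subseteq> {q \<in> space Q. X 0 q \<notin> C} \<union> (\<Union>i<k0. ?E i)"
    proof (rule ccontr)
      assume "\<not> ?thesis"
      then obtain q where q: "q \<in> space Q" "0 < kdag C S 0 (\<lambda>i. X i q)" "X 0 q \<in> C"
          "\<And>i. i < k0 \<Longrightarrow> \<not> (X i q \<in> C \<and> X (Suc i) q \<in> S)"
        using True by auto
      from q(3) have "Kn C 0 (\<lambda>i. X i q) = k0" by (simp add: Kn_zero k0_def)
      with q(2) obtain i where "1 \<le> i" "i \<le> k0 - 1" "X (i - 1) q \<in> C" "X i q \<in> S"
        by (auto simp: kdag_def card_gt_0_iff)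
      with q(4)[of "i - 1"] show False by auto
    qed
    then have "prob ?bad \<le> prob ({q \<in> space Q. X 0 q \<notin> C} \<union> (\<Union>i<k0. ?E i))"
      by (intro finite_measure_mono) measurable
    also have "\<dots> \<le> prob {q \<in> space Q. X 0 q \<notin> C} + prob (\<Union>i<k0. ?E i)"
      by (intro measure_Un_le) measurable
    also have "prob (\<Union>i<k0. ?E i) \<le> (\<Sum>i<k0. prob (?E i))"
      by (intro finite_measure_subadditive_finite) auto
    also have "\<dots> \<le> (\<Sum>i<k0. flux S)"
      by (intro sum_mono prob_entry_le CV S)
    also have "\<dots> = real k0 * flux S" by simp
    also have "real k0 * flux S \<le> (1 / \<delta>) * flux S"
      using small \<open>0 < \<delta>\<close> flux_nonneg[OF CV] by (intro mult_right_mono) (auto simp: k0_def field_simps)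
    finally show ?thesis by (simp add: prob_start_outside)
  qed
  then show ?thesis using good by (simp add: flux_def)
qed

section \<open>The hypercube as a conductance network\<close>

definition flip :: "nat set \<Rightarrow> nat \<Rightarrow> nat set" where
  "flip x i = (if i \<in> x then x - {i} else insert i x)"

lemma finite_hcube [simp]: "finite (hcube n)"
  by (simp add: hcube_def)

lemma card_hcube: "card (hcube n) = 2 ^ n"
  by (simp add: hcube_def card_Pow)

lemma hedge_sym: "hedge n x y \<longleftrightarrow> hedge n y x"
  by (auto simp: hedge_def Un_commute)

lemma hedge_hcube: "hedge n x y \<Longrightarrow> x \<in> hcube n \<and> y \<in> hcube n"
  by (simp add: hedge_def)

lemma hedge_nbrs:
  assumes "x \<in> hcube n"
  shows "{y. hedge n x y} = flip x ` {..<n}"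
proof (intro equalityI subsetI)
  fix y assume "y \<in> {y. hedge n x y}"
  then have y: "y \<in> hcube n" and "card ((x - y) \<union> (y - x)) = 1" by (auto simp: hedge_def)
  then obtain i where i: "(x - y) \<union> (y - x) = {i}" by (auto simp: card_1_singleton_iff)
  then have "i \<in> x \<union> y" by auto
  then have "i < n" using assms y by (auto simp: hcube_def)
  moreover have "y = flip x i"
  proof (rule set_eqI)
    fix j
    from i have "(j \<in> x \<and> j \<notin> y \<or> j \<in> y \<and> j \<notin> x) \<longleftrightarrow> j = i" by (simp add: set_eq_iff)
    then show "j \<in> y \<longleftrightarrow> j \<in> flip x i" by (auto simp: flip_def)
  qed
  ultimately show "y \<in> flip x ` {..<n}" by auto
next
  fix y assume "y \<in> flip x ` {..<n}"
  then obtain i where i: "i < n" "y = flip x i" by auto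
  then have "(x - y) \<union> (y - x) = {i}" by (auto simp: flip_def)
  with i assms show "y \<in> {y. hedge n x y}" by (auto simp: hedge_def hcube_def flip_def)
qed

lemma inj_flip: "inj (flip x)"
  by (auto simp: inj_def flip_def split: if_splits)

lemma finite_nbrs [simp]: "finite {y. hedge n x y}"
  by (rule finite_subset[OF _ finite_hcube[of n]]) (auto simp: hedge_def)

lemma card_nbrs: "x \<in> hcube n \<Longrightarrow> card {y. hedge n x y} = n"
  by (simp add: hedge_nbrs card_image inj_on_subset[OF inj_flip])

lemma Vstar_hcube: "Vstar cs n e \<subseteq> hcube n"
  by (auto simp: Vstar_def occ_def)

lemma Vcirc_hcube: "Vcirc cs n e \<subseteq> hcube n"
  by (auto simp: Vcirc_def)

section \<open>Reversibility with respect to conductances\<close>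

definition conductance :: "real \<Rightarrow> real \<Rightarrow> nat \<Rightarrow> (nat set \<Rightarrow> real) \<Rightarrow> nat set \<Rightarrow> nat set \<Rightarrow> real" where
  "conductance beta cs n e x y = exp (- beta * max (Hn cs n e x) (Hn cs n e y))"

definition total_conductance :: "real \<Rightarrow> real \<Rightarrow> nat \<Rightarrow> (nat set \<Rightarrow> real) \<Rightarrow> nat set \<Rightarrow> real" where
  "total_conductance beta cs n e x = (\<Sum>y\<in>{y. hedge n x y}. conductance beta cs n e x y)"

lemma conductance_sym: "conductance beta cs n e x y = conductance beta cs n e y x"
  by (simp add: conductance_def max.commute)

lemma total_conductance_pos: "hedge n x y \<Longrightarrow> 0 < total_conductance beta cs n e x"
  unfolding total_conductance_def by (rule sum_pos) (auto simp: conductance_def)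

lemma total_conductance_nonneg: "0 \<le> total_conductance beta cs n e x"
  unfolding total_conductance_def by (rule sum_nonneg) (auto simp: conductance_def)

text \<open>Since \<open>max 0 (b - a) = max a b - a\<close>, each weight is the symmetric
  conductance times \<open>exp (beta * Hn cs n e x)\<close>, a factor that cancels in the
  normalisation.\<close>

lemma ptrans_conductance:
  "ptrans beta cs n e x y
     = (if hedge n x y then conductance beta cs n e x y / total_conductance beta cs n e x else 0)"
proof -
  let ?H = "Hn cs n e"
  have *: "exp (- beta * max 0 (?H z - ?H x)) = exp (beta * ?H x) * conductance beta cs n e x z" for z
    unfolding conductance_def exp_add[symmetric] by (simp add: max_def algebra_simps)
  show ?thesis
    unfolding ptrans_def * total_conductance_def sum_distrib_left[symmetric] by simp
qed

lemma Hn_nonpos: "0 \<le> thr cs n \<Longrightarrow> Hn cs n e x \<le> 0"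
  by (auto simp: Hn_def occ_def intro!: mult_nonneg_nonpos)

text \<open>A vertex of \<^term>\<open>Vcirc cs n e\<close> or each of its neighbours has energy zero.\<close>

lemma conductance_Vcirc:
  assumes "0 \<le> thr cs n" "x \<in> Vcirc cs n e" "hedge n x y"
  shows "conductance beta cs n e x y = 1"
proof -
  have "\<not> occ cs n e x \<or> \<not> occ cs n e y"
    using assms(2,3) by (auto simp: Vcirc_def Vstar_def Istar_def)
  then have "Hn cs n e x = 0 \<or> Hn cs n e y = 0" by (auto simp: Hn_def)
  then show ?thesis
    using Hn_nonpos[OF assms(1), of e x] Hn_nonpos[OF assms(1), of e y]
    by (auto simp: conductance_def max_def)
qed

text \<open>The divisor makes the weight agree with the uniform law on \<open>Vcirc\<close>, where
  the total conductance is \<open>n\<close> once the threshold is nonnegative.\<close>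

definition normalised_conductance :: "real \<Rightarrow> real \<Rightarrow> nat \<Rightarrow> (nat set \<Rightarrow> real) \<Rightarrow> nat set \<Rightarrow> real" where
  "normalised_conductance beta cs n e x
     = total_conductance beta cs n e x / (real n * real (card (Vcirc cs n e)))"

lemma normalised_conductance_ptrans:
  "normalised_conductance beta cs n e x * ptrans beta cs n e x y
     = (if hedge n x y then conductance beta cs n e x y / (real n * real (card (Vcirc cs n e))) else 0)"
  using total_conductance_pos[of n x y beta cs e]
  by (auto simp: normalised_conductance_def ptrans_conductance)

text \<open>Detailed balance: the flow over an edge is its conductance up to a constant, hence
  symmetric, and the inflow at \<open>y\<close> sums to its total conductance.\<close>

lemma normalised_conductance_invariant:
  "(\<Sum>x\<in>hcube n. normalised_conductance beta cs n e x * ptrans beta cs n e x y)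
     = normalised_conductance beta cs n e y"
proof -
  have "(\<Sum>x\<in>hcube n. normalised_conductance beta cs n e x * ptrans beta cs n e x y)
      = (\<Sum>x\<in>{x\<in>hcube n. hedge n x y}. conductance beta cs n e x y / (real n * real (card (Vcirc cs n e))))"
    unfolding normalised_conductance_ptrans by (simp add: sum.inter_filter)
  also have "{x\<in>hcube n. hedge n x y} = {x. hedge n y x}"
    by (auto simp: hedge_def Un_commute)
  also have "(\<Sum>x\<in>{x. hedge n y x}. conductance beta cs n e x y / (real n * real (card (Vcirc cs n e))))
      = normalised_conductance beta cs n e y"
    by (simp add: normalised_conductance_def total_conductance_def sum_divide_distrib conductance_sym)
  finally show ?thesis .
qed

lemma normalised_conductance_Vcirc:
  assumes "1 \<le> n" "0 \<le> thr cs n" "x \<in> Vcirc cs n e"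
  shows "normalised_conductance beta cs n e x = unif (Vcirc cs n e) x"
proof -
  have "total_conductance beta cs n e x = real n"
    using assms(3) Vcirc_hcube[of cs n e]
    by (auto simp: total_conductance_def conductance_Vcirc[OF assms(2,3)] card_nbrs subset_iff)
  with assms show ?thesis by (simp add: normalised_conductance_def unif_def)
qed

lemma subinvariant_chain_conductance:
  assumes "is_chain Q X (hcube n) (unif (Vcirc cs n e)) (ptrans beta cs n e)" "1 \<le> n" "0 \<le> thr cs n"
  shows "subinvariant_chain Q X (hcube n) (unif (Vcirc cs n e)) (ptrans beta cs n e)
           (Vcirc cs n e) (normalised_conductance beta cs n e)"
proof
  let ?\<rho> = "normalised_conductance beta cs n e"
  show "0 \<le> ptrans beta cs n e x y" for x y
    by (simp add: ptrans_conductance conductance_def total_conductance_nonneg)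
  show "0 \<le> ?\<rho> x" for x
    by (simp add: normalised_conductance_def total_conductance_nonneg)
  show "(\<Sum>x\<in>hcube n. ?\<rho> x * ptrans beta cs n e x y) \<le> ?\<rho> y" for y
    by (simp add: normalised_conductance_invariant)
  show "unif (Vcirc cs n e) x \<le> ?\<rho> x" if "x \<in> Vcirc cs n e" for x
    using assms(2,3) that by (simp add: normalised_conductance_Vcirc)
qed (use assms in \<open>auto simp: unif_def\<close>)

text \<open>An edge from \<open>Vcirc\<close> to \<open>Vstar\<close> has conductance 1, so it
  carries flow \<open>1 / (n * card Vcirc)\<close>; at most \<open>n\<close> such edges meet a
  vertex of \<open>Vstar\<close>.\<close>

lemma flux_le:
  assumes "1 \<le> n" "0 \<le> thr cs n"
  shows "(\<Sum>x\<in>Vcirc cs n e. \<Sum>y\<in>Vstar cs n e. normalised_conductance beta cs n e x * ptrans beta cs n e x y)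
     \<le> real (card (Vstar cs n e)) / real (card (Vcirc cs n e))"
proof -
  let ?C = "Vcirc cs n e" and ?S = "Vstar cs n e"
  have fin: "finite ?C" by (rule finite_subset[OF Vcirc_hcube]) simp
  have "(\<Sum>x\<in>?C. \<Sum>y\<in>?S. normalised_conductance beta cs n e x * ptrans beta cs n e x y)
      = (\<Sum>y\<in>?S. \<Sum>x\<in>?C. if hedge n x y then 1 / (real n * real (card ?C)) else 0)"
    unfolding normalised_conductance_ptrans
    by (subst sum.swap) (auto intro!: sum.cong simp: conductance_Vcirc[OF assms(2)])
  also have "\<dots> = (\<Sum>y\<in>?S. real (card {x\<in>?C. hedge n x y}) / (real n * real (card ?C)))"
    using fin by (simp add: sum.inter_filter[symmetric])
  also have "\<dots> \<le> (\<Sum>y\<in>?S. real n / (real n * real (card ?C)))"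
  proof (intro sum_mono divide_right_mono)
    fix y assume "y \<in> ?S"
    then have "y \<in> hcube n" using Vstar_hcube by blast
    have "card {x\<in>?C. hedge n x y} \<le> card {x. hedge n y x}"
      using hedge_sym[of n y] by (intro card_mono finite_nbrs) auto
    then show "real (card {x\<in>?C. hedge n x y}) \<le> real n"
      using card_nbrs[OF \<open>y \<in> hcube n\<close>] by simp
  qed simp
  also have "\<dots> = real (card ?S) / real (card ?C)" using assms(1) by simp
  finally show ?thesis .
qed

text \<open>An edge in direction \<open>i\<close> is represented by its endpoint not containing
  \<open>i\<close>, so distinct members stand for disjoint edges.\<close>

definition occ_edges :: "real \<Rightarrow> nat \<Rightarrow> (nat set \<Rightarrow> real) \<Rightarrow> nat \<Rightarrow> nat set set" where
  "occ_edges cs n e i = {x \<in> Pow ({..<n} - {i}). occ cs n e x \<and> occ cs n e (insert i x)}"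

lemma card_Vstar_le: "card (Vstar cs n e) \<le> 2 * (\<Sum>i<n. card (occ_edges cs n e i))"
proof -
  have fin: "finite (occ_edges cs n e i)" for i by (simp add: occ_edges_def)
  have "Vstar cs n e \<subseteq> (\<Union>i<n. occ_edges cs n e i \<union> insert i ` occ_edges cs n e i)"
  proof
    fix x assume "x \<in> Vstar cs n e"
    then obtain y where x: "occ cs n e x" and y: "hedge n x y" "occ cs n e y"
      by (auto simp: Vstar_def Istar_def)
    then have xn: "x \<subseteq> {..<n}" by (auto simp: hedge_def hcube_def)
    from y hedge_nbrs[of x n] hedge_hcube[of n x y] obtain i where i: "i < n" "y = flip x i" by blast
    show "x \<in> (\<Union>i<n. occ_edges cs n e i \<union> insert i ` occ_edges cs n e i)"
    proof (cases "i \<in> x")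
      case True
      then have "x - {i} \<in> occ_edges cs n e i" "x = insert i (x - {i})"
        using i x y xn by (auto simp: occ_edges_def flip_def insert_absorb)
      then show ?thesis using i by blast
    next
      case False
      then have "x \<in> occ_edges cs n e i"
        using i x y xn by (auto simp: occ_edges_def flip_def)
      then show ?thesis using i by blast
    qed
  qed
  then have "card (Vstar cs n e) \<le> card (\<Union>i<n. occ_edges cs n e i \<union> insert i ` occ_edges cs n e i)"
    using fin by (intro card_mono) auto
  also have "\<dots> \<le> (\<Sum>i<n. card (occ_edges cs n e i \<union> insert i ` occ_edges cs n e i))"
    by (intro card_UN_le) simp
  also have "\<dots> \<le> (\<Sum>i<n. 2 * card (occ_edges cs n e i))"
  proof (intro sum_mono)
    fix i
    show "card (occ_edges cs n e i \<union> insert i ` occ_edges cs n e i) \<le> 2 * card (occ_edges cs n e i)"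
      using card_Un_le[of "occ_edges cs n e i" "insert i ` occ_edges cs n e i"]
        card_image_le[OF fin[of i], of "insert i"] by linarith
  qed
  finally show ?thesis by (simp add: sum_distrib_left)
qed

section \<open>The Gaussian environment\<close>

interpretation std_normal: real_distribution std_normal_distribution
  by (rule real_dist_normal_dist)

text \<open>The density is positive everywhere. The equivalence yields both strict monotonicity and
  continuity of the distribution function.\<close>

lemma std_normal_null_iff:
  "A \<in> null_sets std_normal_distribution \<longleftrightarrow> A \<in> null_sets lborel"
proof -
  have "ennreal (std_normal_density x) \<noteq> 0" for x
    using normal_density_pos[of 1 0 x] by (simp add: ennreal_eq_0_iff)
  then have "A \<in> null_sets std_normal_distribution \<longleftrightarrow> A \<in> sets lborel \<and> (AE x in lborel. x \<notin> A)"
    by (subst null_sets_density_iff) auto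
  then show ?thesis by (auto simp: AE_iff_null_sets intro: AE_not_in)
qed

lemma std_normal_cdf_strict_mono:
  assumes "a < b" shows "cdf std_normal_distribution a < cdf std_normal_distribution b"
proof (rule ccontr)
  assume "\<not> ?thesis"
  with std_normal.cdf_diff_eq[OF assms] have "measure std_normal_distribution {a<..b} \<le> 0" by simp
  then have "{a<..b} \<in> null_sets std_normal_distribution"
    by (auto simp: null_sets_def std_normal.emeasure_eq_measure measure_le_0_iff)
  then have "{a<..b} \<in> null_sets lborel" by (simp add: std_normal_null_iff)
  with assms show False by (auto simp: null_sets_def)
qed

lemma std_normal_cdf_isCont: "isCont (cdf std_normal_distribution) x"
proof -
  have "{x} \<in> null_sets std_normal_distribution" by (subst std_normal_null_iff) (simp add: null_sets_def)
  then show ?thesis by (simp add: std_normal.isCont_cdf measure_eq_0_null_sets)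
qed

text \<open>\<open>thr\<close> is a definite description, so its defining property needs existence
  (intermediate value theorem) and uniqueness (strict monotonicity).\<close>

lemma std_normal_quantile:
  assumes "0 < r" "r < 1"
  shows "\<exists>!u. measure std_normal_distribution {..-u} = r"
proof (rule ex_ex1I)
  let ?F = "cdf std_normal_distribution"
  have "\<forall>\<^sub>F x in at_bot. ?F x < r"
    using std_normal.cdf_lim_at_bot assms(1) by (rule order_tendstoD)
  then obtain a where a: "\<And>x. x \<le> a \<Longrightarrow> ?F x < r" by (auto simp: eventually_at_bot_linorder)
  have "\<forall>\<^sub>F x in at_top. r < ?F x"
    using std_normal.cdf_lim_at_top_prob assms(2) by (rule order_tendstoD)
  then obtain b where b: "\<And>x. b \<le> x \<Longrightarrow> r < ?F x" by (auto simp: eventually_at_top_linorder)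
  have "\<exists>x\<ge>min a b. x \<le> max a b \<and> ?F x = r"
    using a[of "min a b"] b[of "max a b"] by (intro IVT) (auto simp: std_normal_cdf_isCont intro: less_imp_le)
  then obtain x where "?F x = r" by auto
  then show "\<exists>u. measure std_normal_distribution {..-u} = r"
    by (intro exI[of _ "-x"]) (simp add: cdf_def)
next
  fix u v
  assume "measure std_normal_distribution {..-u} = r" "measure std_normal_distribution {..-v} = r"
  then have "cdf std_normal_distribution (-u) = cdf std_normal_distribution (-v)" by (simp add: cdf_def)
  then show "u = v"
    using std_normal_cdf_strict_mono[of "-u" "-v"] std_normal_cdf_strict_mono[of "-v" "-u"]
    by (cases u v rule: linorder_cases) auto
qed

lemma measure_thr:
  assumes "0 < cs" "2 \<le> n"
  shows "measure std_normal_distribution {..- thr cs n} = real n powr (- cs)"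
proof -
  have "real n powr (- cs) < 1" using assms by (intro powr_less_one) auto
  then show ?thesis
    unfolding thr_def using assms by (intro theI'[OF std_normal_quantile]) auto
qed

text \<open>Once \<open>real n powr (- cs)\<close> is below the distribution function at 0,
  monotonicity makes \<open>- thr cs n\<close> negative. The sign is what makes all energies
  nonpositive.\<close>

lemma eventually_thr_nonneg:
  assumes "0 < cs"
  shows "\<forall>\<^sub>F n in sequentially. 0 \<le> thr cs n"
proof -
  have "0 < cdf std_normal_distribution 0"
    using std_normal_cdf_strict_mono[of "-1" 0] std_normal.cdf_nonneg[of "-1"] by simp
  moreover have "(\<lambda>n. real n powr (- cs)) \<longlonglongrightarrow> 0" using assms by real_asymp
  ultimately have "\<forall>\<^sub>F n in sequentially. real n powr (- cs) < cdf std_normal_distribution 0"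
    by (intro order_tendstoD(2))
  then show ?thesis using eventually_ge_at_top[of 2]
  proof eventually_elim
    case (elim n)
    then have "cdf std_normal_distribution (- thr cs n) < cdf std_normal_distribution 0"
      using measure_thr[OF assms] by (simp add: cdf_def)
    then show ?case
      using std_normal_cdf_strict_mono[of 0 "- thr cs n"] by (cases "- thr cs n" "0::real" rule: linorder_cases) auto
  qed
qed

text \<open>Pairwise independence keeps the variance below the mean, so by Chebyshev's inequality a
  deviation as large as the mean has probability at most 1 over the mean.\<close>

lemma (in prob_space) pairwise_indep_count_ge:
  assumes I: "finite I" "I \<noteq> {}" and A: "\<And>i. i \<in> I \<Longrightarrow> A i \<in> events" and "0 < r"
    and 1: "\<And>i. i \<in> I \<Longrightarrow> prob (A i) = r"
    and 2: "\<And>i j. i \<in> I \<Longrightarrow> j \<in> I \<Longrightarrow> i \<noteq> j \<Longrightarrow> prob (A i \<inter> A j) = r\<^sup>2"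
  shows "prob {w \<in> space M. 2 * (real (card I) * r) \<le> real (card {i\<in>I. w \<in> A i})} \<le> 1 / (real (card I) * r)"
proof -
  define m where "m = real (card I) * r"
  have "0 < m" using I \<open>0 < r\<close> by (simp add: m_def card_gt_0_iff)
  define S where "S w = (\<Sum>i\<in>I. indicator (A i) w :: real)" for w
  have card: "real (card {i \<in> I. w \<in> A i}) = S w" for w
    using I by (simp add: S_def indicator_def sum.If_cases Int_def)
  have S2: "(S w)\<^sup>2 = (\<Sum>i\<in>I. \<Sum>j\<in>I. indicator (A i \<inter> A j) w)" for w
    by (simp add: S_def power2_eq_square sum_product indicator_inter_arith)
  have int: "integrable M S" "integrable M (\<lambda>w. (S w)\<^sup>2)"
    unfolding S2 unfolding S_def using A
    by (auto intro!: Bochner_Integration.integrable_sum simp: emeasure_eq_measure)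
  have ES: "expectation S = m"
    unfolding S_def m_def using A by (subst Bochner_Integration.integral_sum) (auto simp: emeasure_eq_measure 1)
  have "expectation (\<lambda>w. (S w)\<^sup>2) = (\<Sum>i\<in>I. \<Sum>j\<in>I. prob (A i \<inter> A j))"
    unfolding S2 using A
    by (subst Bochner_Integration.integral_sum)
       (auto simp: emeasure_eq_measure intro!: sum.cong Bochner_Integration.integrable_sum)
  \<comment> \<open>The diagonal term gives \<open>r\<close>; the off-diagonal terms are completed
    to a full sum of \<open>r\<^sup>2\<close>.\<close>
  also have "\<dots> \<le> (\<Sum>i\<in>I. r + (\<Sum>j\<in>I. r\<^sup>2))"
  proof (intro sum_mono)
    fix i assume i: "i \<in> I"
    then have "(\<Sum>j\<in>I. prob (A i \<inter> A j)) = prob (A i) + (\<Sum>j\<in>I - {i}. prob (A i \<inter> A j))"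
      using I by (simp add: sum.remove)
    also have "(\<Sum>j\<in>I - {i}. prob (A i \<inter> A j)) = (\<Sum>j\<in>I - {i}. r\<^sup>2)"
      using i by (intro sum.cong) (auto simp: 2)
    also have "\<dots> \<le> (\<Sum>j\<in>I. r\<^sup>2)" using I by (intro sum_mono2) auto
    finally show "(\<Sum>j\<in>I. prob (A i \<inter> A j)) \<le> r + (\<Sum>j\<in>I. r\<^sup>2)" using i by (simp add: 1)
  qed
  also have "\<dots> = m + m\<^sup>2" by (simp add: m_def power2_eq_square algebra_simps)
  finally have var: "variance S \<le> m" using variance_eq[OF int] by (simp add: ES)
  have "prob {w \<in> space M. 2 * m \<le> S w} \<le> prob {w \<in> space M. m \<le> \<bar>S w - expectation S\<bar>}"
    using int by (intro finite_measure_mono) (auto simp: ES)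
  also have "\<dots> \<le> variance S / m\<^sup>2"
    using int \<open>0 < m\<close> by (intro Chebyshev_inequality) auto
  also have "\<dots> \<le> m / m\<^sup>2" using var by (intro divide_right_mono) auto
  also have "\<dots> = 1 / m" by (simp add: power2_eq_square)
  finally show ?thesis by (simp add: card m_def)
qed

section \<open>Almost sure size of \<open>Vstar\<close>\<close>

locale gaussian_environment = prob_space M for M :: "'w measure" +
  fixes g :: "nat \<Rightarrow> nat set \<Rightarrow> 'w \<Rightarrow> real" and cs :: real
  assumes cs: "2 < cs"
    and dist: "\<And>n x. 1 \<le> n \<Longrightarrow> x \<in> hcube n \<Longrightarrow>
           distributed M lborel (g n x) (\<lambda>v. ennreal (std_normal_density v))"
    and indep: "indep_vars (\<lambda>_. borel) (\<lambda>(n, x). g n x) {(n, x). 1 \<le> n \<and> x \<in> hcube n}"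
begin

definition occ_event :: "nat \<Rightarrow> nat set \<Rightarrow> 'w set" where
  "occ_event n x = {w \<in> space M. g n x w \<le> - thr cs n}"

lemma occ_event_vimage: "occ_event n x = g n x -` {..- thr cs n} \<inter> space M"
  by (auto simp: occ_event_def)

lemma occ_event_sets: "1 \<le> n \<Longrightarrow> x \<in> hcube n \<Longrightarrow> occ_event n x \<in> events"
  unfolding occ_event_vimage using distributed_measurable[OF dist] by (intro measurable_sets) auto

lemma prob_occ_event:
  assumes "2 \<le> n" "x \<in> hcube n"
  shows "prob (occ_event n x) = real n powr (- cs)"
proof -
  have d: "distributed M lborel (g n x) (\<lambda>v. ennreal (std_normal_density v))"
    using assms by (intro dist) auto
  have "measure (distr M lborel (g n x)) {..- thr cs n} = prob (occ_event n x)"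
    unfolding occ_event_vimage using distributed_measurable[OF d] by (intro measure_distr) auto
  then show ?thesis
    using measure_thr[of cs n] cs assms(1) by (simp add: distributed_distr_eq_density[OF d])
qed

lemma prob_all_occ:
  assumes n: "2 \<le> n" and A: "A \<subseteq> hcube n" "A \<noteq> {}"
  shows "prob (\<Inter>x\<in>A. occ_event n x) = (real n powr (- cs)) ^ card A"
proof -
  have fin: "finite A" using A(1) finite_hcube finite_subset by blast
  have "prob (\<Inter>i\<in>Pair n ` A. (case i of (n, x) \<Rightarrow> g n x) -` {..- thr cs n} \<inter> space M)
     = (\<Prod>i\<in>Pair n ` A. prob ((case i of (n, x) \<Rightarrow> g n x) -` {..- thr cs n} \<inter> space M))"
    using n A fin by (intro indep_varsD[OF indep]) auto
  then have "prob (\<Inter>x\<in>A. occ_event n x) = (\<Prod>x\<in>A. prob (occ_event n x))"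
    by (simp add: occ_event_vimage prod.reindex inj_on_def image_image del: INT_simps INT_extend_simps)
  also have "\<dots> = (\<Prod>x\<in>A. real n powr (- cs))"
    using A by (intro prod.cong) (auto simp: prob_occ_event[OF n])
  finally show ?thesis by simp
qed

definition edge_event :: "nat \<Rightarrow> nat \<Rightarrow> nat set \<Rightarrow> 'w set" where
  "edge_event n i x = occ_event n x \<inter> occ_event n (insert i x)"

lemma edge_event_sets:
  "1 \<le> n \<Longrightarrow> i < n \<Longrightarrow> x \<in> Pow ({..<n} - {i}) \<Longrightarrow> edge_event n i x \<in> events"
  unfolding edge_event_def by (intro sets.Int occ_event_sets) (auto simp: hcube_def)

text \<open>The edges in a fixed direction are disjoint, hence their events are independent.\<close>

lemma prob_occ_edges:
  assumes n: "2 \<le> n" and i: "i < n"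
  defines "m \<equiv> 2 ^ (n - 1) * (real n powr (- cs))\<^sup>2"
  shows "prob {w \<in> space M. 2 * m \<le> real (card {x \<in> Pow ({..<n} - {i}). w \<in> edge_event n i x})} \<le> 1 / m"
proof -
  let ?I = "Pow ({..<n} - {i})"
  have card: "real (card ?I) = 2 ^ (n - 1)" using i by (simp add: card_Pow)
  have "prob {w \<in> space M. 2 * (real (card ?I) * (real n powr (- cs))\<^sup>2) \<le> real (card {x \<in> ?I. w \<in> edge_event n i x})}
     \<le> 1 / (real (card ?I) * (real n powr (- cs))\<^sup>2)"
  proof (rule pairwise_indep_count_ge)
    show "edge_event n i x \<in> events" if "x \<in> ?I" for x
      using n i that by (intro edge_event_sets) auto
    show "prob (edge_event n i x) = (real n powr (- cs))\<^sup>2" if "x \<in> ?I" for x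
    proof -
      have "card {x, insert i x} = 2" using that by (auto simp: card_insert_if)
      moreover have "edge_event n i x = (\<Inter>v\<in>{x, insert i x}. occ_event n v)" by (auto simp: edge_event_def)
      ultimately show ?thesis using prob_all_occ[OF n, of "{x, insert i x}"] that i by (auto simp: hcube_def)
    qed
    show "prob (edge_event n i x \<inter> edge_event n i y) = ((real n powr (- cs))\<^sup>2)\<^sup>2"
      if "x \<in> ?I" "y \<in> ?I" "x \<noteq> y" for x y
    proof -
      \<comment> \<open>Two different edges in direction \<open>i\<close> have four different
        endpoints, so four independent occupations are involved.\<close>
      have "insert i x \<noteq> insert i y" using that by blast
      moreover have "insert i x \<noteq> x" "insert i x \<noteq> y" "insert i y \<noteq> x" "insert i y \<noteq> y" using that by blast+
      ultimately have "card {x, insert i x, y, insert i y} = 4" using that by (auto simp: card_insert_if)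
      moreover have "edge_event n i x \<inter> edge_event n i y = (\<Inter>v\<in>{x, insert i x, y, insert i y}. occ_event n v)"
        by (auto simp: edge_event_def)
      ultimately show ?thesis
        using prob_all_occ[OF n, of "{x, insert i x, y, insert i y}"] that i
        by (auto simp: hcube_def power_mult[symmetric])
    qed
    show "0 < (real n powr (- cs))\<^sup>2" using n by simp
  qed auto
  then show ?thesis by (simp only: card m_def)
qed

text \<open>In one direction the count exceeds twice its mean \<open>m n\<close> with probability at
  most \<open>1 / m n\<close>, which decays exponentially up to powers of \<open>n\<close>. The
  union bound over \<open>n\<close> directions therefore remains summable.\<close>

lemma AE_card_Vstar:
  "AE w in M. \<forall>\<^sub>F n in sequentially.
     real (card (Vstar cs n (\<lambda>x. g n x w))) \<le> 2 ^ n * (2 * real n powr (1 - 2 * cs))"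
proof -
  define m where "m n = 2 ^ (n - 1) * (real n powr (- cs))\<^sup>2" for n
  define A where "A n i = {w \<in> space M. 2 * m n \<le> real (card {x \<in> Pow ({..<n} - {i}). w \<in> edge_event n i x})}" for n i
  \<comment> \<open>Levels below 2 are left out, since there the prescribed tail is 0 or 1 and no
    threshold attains it; Borel-Cantelli ignores finitely many levels.\<close>
  define B where "B n = (if 2 \<le> n then (\<Union>i<n. A n i) else {})" for n
  have A_sets: "A n i \<in> events" if "2 \<le> n" "i < n" for n i
  proof -
    have card: "real (card {x \<in> Pow ({..<n} - {i}). w \<in> edge_event n i x})
        = (\<Sum>x\<in>Pow ({..<n} - {i}). indicator (edge_event n i x) w)" for w
      by (simp add: indicator_def sum.If_cases Int_def)
    have "(\<lambda>w. \<Sum>x\<in>Pow ({..<n} - {i}). indicator (edge_event n i x) w :: real) \<in> borel_measurable M"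
      using that by (intro borel_measurable_sum borel_measurable_indicator edge_event_sets) auto
    then show ?thesis unfolding A_def card by measurable
  qed
  have B_sets: "B n \<in> events" for n
    unfolding B_def using A_sets by auto
  have B_le: "prob (B n) \<le> real n / m n" for n
  proof (cases "2 \<le> n")
    case True
    have "prob (B n) \<le> (\<Sum>i<n. prob (A n i))"
      unfolding B_def using True A_sets by (auto intro!: finite_measure_subadditive_finite)
    also have "\<dots> \<le> (\<Sum>i<n. 1 / m n)"
      unfolding A_def m_def using True by (intro sum_mono prob_occ_edges) auto
    finally show ?thesis by simp
  qed (simp add: B_def m_def)
  have m: "real n / m n = 2 * (real n * real n powr (2 * cs) / 2 ^ n)" for n
    unfolding m_def
    by (cases n) (simp_all add: power2_eq_square powr_add[symmetric] powr_minus field_simps)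
  have "(\<lambda>n. 2 * (real n * real n powr (2 * cs) / 2 ^ n)) \<in> O(\<lambda>n. real n powr - 2)"
    using cs by real_asymp
  then have "summable (\<lambda>n. real n / m n)"
    unfolding m by (rule summable_comparison_test_bigo[rotated]) (simp add: summable_real_powr_iff)
  then have "summable (\<lambda>n. prob (B n))"
    by (rule summable_comparison_test') (use B_le in auto)
  then have "AE w in M. \<forall>\<^sub>F n in sequentially. w \<in> space M - B n"
    using B_sets by (intro borel_cantelli_AE1) (auto simp: emeasure_eq_measure)
  then show ?thesis
  proof (rule AE_mp[OF _ AE_I2], intro impI)
    fix w assume "w \<in> space M" "\<forall>\<^sub>F n in sequentially. w \<in> space M - B n"
    from this(2) eventually_ge_at_top[of 2]
    show "\<forall>\<^sub>F n in sequentially. real (card (Vstar cs n (\<lambda>x. g n x w))) \<le> 2 ^ n * (2 * real n powr (1 - 2 * cs))"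
    proof eventually_elim
      case (elim n)
      let ?e = "\<lambda>x. g n x w"
      have "real (card (occ_edges cs n ?e i)) \<le> 2 * m n" if "i < n" for i
      proof -
        have "occ_edges cs n ?e i = {x \<in> Pow ({..<n} - {i}). w \<in> edge_event n i x}"
          using that \<open>w \<in> space M\<close>
          by (auto simp: occ_edges_def edge_event_def occ_event_def occ_def hcube_def)
        moreover have "w \<notin> A n i" using elim that by (auto simp: B_def)
        ultimately show ?thesis using \<open>w \<in> space M\<close> by (simp add: A_def)
      qed
      then have "(\<Sum>i<n. real (card (occ_edges cs n ?e i))) \<le> (\<Sum>i<n. 2 * m n)"
        by (intro sum_mono) auto
      moreover have "real (card (Vstar cs n ?e)) \<le> 2 * (\<Sum>i<n. real (card (occ_edges cs n ?e i)))"
        using of_nat_mono[OF card_Vstar_le[of cs n ?e], where 'a=real] by simp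
      \<comment> \<open>The factors are two endpoints per edge, \<open>n\<close> directions and the
        level \<open>2 * m n\<close>; one factor 2 then turns \<open>2 ^ (n - 1)\<close> into
        \<open>2 ^ n\<close>.\<close>
      ultimately have "real (card (Vstar cs n ?e)) \<le> 2 * (real n * (2 * m n))" by simp
      also have "\<dots> = 2 ^ n * (2 * (real n * (real n powr (- cs))\<^sup>2))"
        unfolding m_def using elim(2) by (cases n) auto
      also have "real n * (real n powr (- cs))\<^sup>2 = real n powr (1 - 2 * cs)"
        using elim(2) by (simp add: power2_eq_square powr_add[symmetric] powr_mult_base)
      finally show ?case .
    qed
  qed
qed

text \<open>Eventually \<open>Vstar\<close> fills at most half of the cube, so the ratio is at most
  \<open>4 * real n powr (1 - 2 * cs)\<close>. The target exponent is larger by 1, and this spare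
  factor \<open>n\<close> absorbs the 4 as soon as \<open>4 \<le> n\<close>.\<close>

lemma AE_Vstar_ratio:
  "AE w in M. \<forall>\<^sub>F n in sequentially.
     real (card (Vstar cs n (\<lambda>x. g n x w))) / real (card (Vcirc cs n (\<lambda>x. g n x w)))
       \<le> real n powr (- 2 * (cs - 1))"
  using AE_card_Vstar
proof (rule AE_mp[OF _ AE_I2], intro impI)
  fix w assume "\<forall>\<^sub>F n in sequentially.
     real (card (Vstar cs n (\<lambda>x. g n x w))) \<le> 2 ^ n * (2 * real n powr (1 - 2 * cs))"
  moreover have "\<forall>\<^sub>F n in sequentially. real n powr (1 - 2 * cs) \<le> 1 / 4"
    using cs by real_asymp
  ultimately show "\<forall>\<^sub>F n in sequentially.
     real (card (Vstar cs n (\<lambda>x. g n x w))) / real (card (Vcirc cs n (\<lambda>x. g n x w)))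
       \<le> real n powr (- 2 * (cs - 1))"
    using eventually_ge_at_top[of 4]
  proof eventually_elim
    case (elim n)
    let ?S = "Vstar cs n (\<lambda>x. g n x w)" and ?C = "Vcirc cs n (\<lambda>x. g n x w)"
    let ?r = "real n powr (1 - 2 * cs)"
    have "card ?C = 2 ^ n - card ?S"
      unfolding Vcirc_def using Vstar_hcube[of cs n] finite_subset[OF Vstar_hcube finite_hcube]
      by (simp add: card_Diff_subset card_hcube)
    moreover have "card ?S \<le> 2 ^ n"
      using card_mono[OF finite_hcube Vstar_hcube] by (simp add: card_hcube)
    ultimately have C: "2 ^ n - real (card ?S) \<le> real (card ?C)" by (simp add: of_nat_diff)
    have "2 ^ n * (2 * ?r) \<le> 2 ^ n * (1 / 2)" using elim(2) by (intro mult_left_mono) auto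
    with elim(1) C have half: "2 ^ n / 2 \<le> real (card ?C)" by linarith
    have "real (card ?S) / real (card ?C) \<le> (2 ^ n * (2 * ?r)) / (2 ^ n / 2)"
      using elim(1) half by (intro frac_le) auto
    also have "\<dots> = 4 * ?r" by simp
    also have "\<dots> \<le> real n * ?r" using elim(3) by (intro mult_right_mono) auto
    also have "\<dots> = real n powr (- 2 * (cs - 1))"
      using elim(3) by (simp add: powr_mult_base algebra_simps)
    finally show ?case .
  qed
qed

end

section \<open>Combining the environment estimate with the chain estimate\<close>

theorem theorem3p1:
  fixes M :: "'w measure" and g :: "nat \<Rightarrow> nat set \<Rightarrow> 'w \<Rightarrow> real"
    and cstar beta :: real
  assumes "prob_space M"
    and "cstar > 2" and "beta > 0"
    and "\<And>n x. 1 \<le> n \<Longrightarrow> x \<in> hcube n \<Longrightarrow>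
           distributed M lborel (g n x) (\<lambda>v. ennreal (std_normal_density v))"
    and "prob_space.indep_vars M (\<lambda>_. borel) (\<lambda>(n, x). g n x) {(n, x). 1 \<le> n \<and> x \<in> hcube n}"
  shows "\<exists>\<Omega>'\<in>sets M. measure M \<Omega>' = 1 \<and>
     (\<forall>(t::real) (ccirc::real) (a::nat \<Rightarrow> real). 0 < t \<longrightarrow> 0 < ccirc \<longrightarrow> (\<forall>n. 0 < a n) \<longrightarrow>
       (\<exists>f::nat \<Rightarrow> real. f \<in> O(\<lambda>n. real n powr (- (cstar - 1))) \<and>
         (\<forall>\<omega>\<in>\<Omega>'. \<forall>\<^sub>F n in sequentially.
            \<forall>(Q::'q measure) (X::nat \<Rightarrow> 'q \<Rightarrow> nat set).
              is_chain Q X (hcube n) (unif (Vcirc cstar n (\<lambda>x. g n x \<omega>)))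
                (ptrans beta cstar n (\<lambda>x. g n x \<omega>)) \<longrightarrow>
              measure Q {q \<in> space Q.
                  real (kcirc a t n)
                    \<le> real (kdag (Vcirc cstar n (\<lambda>x. g n x \<omega>)) (Vstar cstar n (\<lambda>x. g n x \<omega>))
                                 (kcirc a t n) (\<lambda>i. X i q))
                \<and> real (kdag (Vcirc cstar n (\<lambda>x. g n x \<omega>)) (Vstar cstar n (\<lambda>x. g n x \<omega>))
                                 (kcirc a t n) (\<lambda>i. X i q))
                    \<le> (1 + real n powr (- ccirc)) * real (kcirc a t n)}
              \<ge> 1 - real n powr (- 2 * (cstar - 1) + ccirc) * (1 + f n))))"
proof -
  interpret prob_space M by fact
  have pos: "0 < cstar" using assms(2) by simp
  interpret gaussian_environment M g cstar
    using assms by unfold_locales auto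
  let ?e = "\<lambda>n \<omega> x. g n x \<omega>"
  \<comment> \<open>The exceptional null set is fixed before \<open>t\<close>, \<open>ccirc\<close>
    and \<open>a\<close>: the ratio bound concerns the environment alone.\<close>
  obtain N where N: "N \<in> null_sets M" and
    ratio: "\<And>\<omega>. \<omega> \<in> space M - N \<Longrightarrow> \<forall>\<^sub>F n in sequentially.
       real (card (Vstar cstar n (?e n \<omega>))) / real (card (Vcirc cstar n (?e n \<omega>)))
         \<le> real n powr (- 2 * (cstar - 1))"
    using AE_Vstar_ratio by (rule AE_E3) blast
  show ?thesis
  proof (intro bexI[of _ "space M - N"] conjI allI impI exI[of _ "\<lambda>_. 0"] ballI)
    show "prob (space M - N) = 1"
      using N by (simp add: prob_compl null_setsD2 measure_eq_0_null_sets)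
  next
    fix t ccirc :: real and a :: "nat \<Rightarrow> real" and \<omega>
    assume "0 < ccirc" and "\<omega> \<in> space M - N"
    \<comment> \<open>The default value of \<open>Kn\<close> is a fixed number, so this holds for
      large \<open>n\<close>; it handles the levels with \<open>kcirc a t n = 0\<close>.\<close>
    have "\<forall>\<^sub>F n in sequentially. real (LEAST k. False) * real n powr (- ccirc) \<le> 1"
      using \<open>0 < ccirc\<close> by real_asymp
    with ratio[OF \<open>\<omega> \<in> space M - N\<close>]
    show "\<forall>\<^sub>F n in sequentially.
            \<forall>(Q::'q measure) (X::nat \<Rightarrow> 'q \<Rightarrow> nat set).
              is_chain Q X (hcube n) (unif (Vcirc cstar n (?e n \<omega>))) (ptrans beta cstar n (?e n \<omega>)) \<longrightarrow>
              measure Q {q \<in> space Q.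
                  real (kcirc a t n)
                    \<le> real (kdag (Vcirc cstar n (?e n \<omega>)) (Vstar cstar n (?e n \<omega>)) (kcirc a t n) (\<lambda>i. X i q))
                \<and> real (kdag (Vcirc cstar n (?e n \<omega>)) (Vstar cstar n (?e n \<omega>)) (kcirc a t n) (\<lambda>i. X i q))
                    \<le> (1 + real n powr (- ccirc)) * real (kcirc a t n)}
              \<ge> 1 - real n powr (- 2 * (cstar - 1) + ccirc) * (1 + 0)"
      using eventually_thr_nonneg[OF pos] eventually_ge_at_top[of 1]
    proof (eventually_elim, intro allI impI)
      fix n and Q :: "'q measure" and X
      assume ratio_n: "real (card (Vstar cstar n (?e n \<omega>))) / real (card (Vcirc cstar n (?e n \<omega>)))
         \<le> real n powr (- 2 * (cstar - 1))"
        and small: "real (LEAST k. False) * real n powr (- ccirc) \<le> 1"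
        and thr: "0 \<le> thr cstar n" and n: "1 \<le> n"
        and chain: "is_chain Q X (hcube n) (unif (Vcirc cstar n (?e n \<omega>))) (ptrans beta cstar n (?e n \<omega>))"
      let ?flux = "\<Sum>x\<in>Vcirc cstar n (?e n \<omega>). \<Sum>y\<in>Vstar cstar n (?e n \<omega>).
        normalised_conductance beta cstar n (?e n \<omega>) x * ptrans beta cstar n (?e n \<omega>) x y"
      \<comment> \<open>Here \<open>\<delta>\<close> is \<open>real n powr (- ccirc)\<close>;
        dividing by it adds \<open>ccirc\<close> to the exponent.\<close>
      have "?flux / real n powr (- ccirc) \<le> real n powr (- 2 * (cstar - 1)) / real n powr (- ccirc)"
        using flux_le[OF n thr] ratio_n by (intro divide_right_mono) (auto intro: order.trans)
      also have "\<dots> = real n powr (- 2 * (cstar - 1) + ccirc)"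
        using powr_diff[of "real n" "- 2 * (cstar - 1)" "- ccirc"] by simp
      finally have "1 - real n powr (- 2 * (cstar - 1) + ccirc) * (1 + 0) \<le> 1 - ?flux / real n powr (- ccirc)"
        by simp
      also have "\<dots> \<le> measure Q {q \<in> space Q.
                  real (kcirc a t n)
                    \<le> real (kdag (Vcirc cstar n (?e n \<omega>)) (Vstar cstar n (?e n \<omega>)) (kcirc a t n) (\<lambda>i. X i q))
                \<and> real (kdag (Vcirc cstar n (?e n \<omega>)) (Vstar cstar n (?e n \<omega>)) (kcirc a t n) (\<lambda>i. X i q))
                    \<le> (1 + real n powr (- ccirc)) * real (kcirc a t n)}"
        using n small
        by (intro kdag_ratio_prob[OF subinvariant_chain_conductance[OF chain n thr]] Vcirc_hcube Vstar_hcube) auto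
      finally show "1 - real n powr (- 2 * (cstar - 1) + ccirc) * (1 + 0) \<le> measure Q {q \<in> space Q.
                  real (kcirc a t n)
                    \<le> real (kdag (Vcirc cstar n (?e n \<omega>)) (Vstar cstar n (?e n \<omega>)) (kcirc a t n) (\<lambda>i. X i q))
                \<and> real (kdag (Vcirc cstar n (?e n \<omega>)) (Vstar cstar n (?e n \<omega>)) (kcirc a t n) (\<lambda>i. X i q))
                    \<le> (1 + real n powr (- ccirc)) * real (kcirc a t n)}" .
    qed
  qed (use N in auto)
qed

end
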